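(* Let $n\geq 3$ and let $G$ be an edge-colored $K^{(3)}_{n,n,n}$ with partite sets $V_1,V_2,V_3$, containing no rainbow copy of $\mathcal{M}$, with $k=|C(G)|\geq 3$. Then, numbering the colors $1,\ldots,k$, some partite set $V_\ell$ can be partitioned into $k$ parts $V_{\ell,1},\ldots,V_{\ell,k}$ such that for each $i\in[k]$, all edges containing a vertex of $V_{\ell,i}$ have color $i$.
   Context: $K^{(3)}_{n,n,n}$ with partite sets $V_1,V_2,V_3$ (disjoint, each of size $n$) is the 3-graph whose edges are all $\{x,y,z\}$ with $x\in V_1,y\in V_2,z\in V_3$. An edge-coloring is any map from edges to colors; $C(G)$ is the set of colors used; a copy is rainbow if its edges have pairwise distinct colors. The messy path $\mathcal{M}$ is the 3-graph with edges $\{v_1v_2v_3,v_2v_3v_4,v_4v_5v_6\}$. *)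

theory Defs
  imports "HOL-Library.Disjoint_Sets"
begin

text \<open>A 3-graph is represented by its set of edges, an edge being a 3-element vertex set.\<close>

definition complete_tripartite3 :: "(nat \<Rightarrow> 'a set) \<Rightarrow> 'a set set" where
  "complete_tripartite3 V = {{x, y, z} | x y z. x \<in> V 1 \<and> y \<in> V 2 \<and> z \<in> V 3}"

definition messy_path :: "nat set set" where
  "messy_path = {{1, 2, 3}, {2, 3, 4}, {4, 5, 6}}"

definition is_copy :: "'b set set \<Rightarrow> 'a set set \<Rightarrow> bool" where
  "is_copy H F \<longleftrightarrow> (\<exists>\<phi>. inj_on \<phi> (\<Union>H) \<and> F = (\<lambda>e. \<phi> ` e) ` H)"

definition contains_rainbow_copy :: "'a set set \<Rightarrow> ('a set \<Rightarrow> 'c) \<Rightarrow> 'b set set \<Rightarrow> bool" where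
  "contains_rainbow_copy E c H \<longleftrightarrow> (\<exists>F \<subseteq> E. is_copy H F \<and> inj_on c F)"

definition used_colors :: "'a set set \<Rightarrow> ('a set \<Rightarrow> 'c) \<Rightarrow> 'c set" where
  "used_colors E c = c ` E"

end

theory Submission imports Defs begin

text \<open>
  View the coloring as a function \<open>f x y z\<close> on a grid. Having no rainbow messy path means: if two
  points on an axis-parallel line have different colors \<open>\<alpha>\<close>, \<open>\<beta>\<close>, then in the two layers
  orthogonal to the line at these points, every point sharing no further coordinate with the line has
  color \<open>\<alpha>\<close> or \<open>\<beta>\<close>.

  If some line carries three colors, intersecting these constraints shows that every layer orthogonal
  to it is monochromatic. Otherwise every non-constant line carries exactly two colors, which then
  are the only ones occurring off the line in both remaining coordinates; playing such lines in
  different directions against each other excludes a third color altogether.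
\<close>

section \<open>Messy paths in terms of grid colorings\<close>

text \<open>The points \<open>(a, y, z)\<close>, \<open>(b, y, z)\<close> and
  \<open>(b, y', z')\<close> are the edges of a messy path in order. The layer of \<open>a\<close>
  is covered as well, by exchanging \<open>a\<close> and \<open>b\<close>.\<close>

definition messy_free_along ::
  "'x set \<Rightarrow> 'y set \<Rightarrow> 'z set \<Rightarrow> ('x \<Rightarrow> 'y \<Rightarrow> 'z \<Rightarrow> 'c) \<Rightarrow> bool" where
  "messy_free_along X Y Z f \<longleftrightarrow>
     (\<forall>a\<in>X. \<forall>b\<in>X. \<forall>y\<in>Y. \<forall>z\<in>Z. \<forall>y'\<in>Y. \<forall>z'\<in>Z.
        f a y z \<noteq> f b y z \<longrightarrow> y' \<noteq> y \<longrightarrow> z' \<noteq> z \<longrightarrow> f b y' z' \<in> {f a y z, f b y z})"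

definition rainbow_line ::
  "'x set \<Rightarrow> 'y set \<Rightarrow> 'z set \<Rightarrow> ('x \<Rightarrow> 'y \<Rightarrow> 'z \<Rightarrow> 'c) \<Rightarrow> bool" where
  "rainbow_line X Y Z f \<longleftrightarrow>
     (\<exists>a\<in>X. \<exists>b\<in>X. \<exists>d\<in>X. \<exists>y\<in>Y. \<exists>z\<in>Z.
        f a y z \<noteq> f b y z \<and> f a y z \<noteq> f d y z \<and> f b y z \<noteq> f d y z)"

text \<open>Having at least three elements, in the form needed below: a coordinate can be chosen
  away from any two given ones.\<close>

definition has_third :: "'x set \<Rightarrow> bool" where
  "has_third X \<longleftrightarrow> (\<forall>a b. \<exists>d\<in>X. d \<noteq> a \<and> d \<noteq> b)"

lemma has_third_if_card_ge_3:
  fixes X :: "'a set"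
  assumes "finite X" "card X \<ge> 3"
  shows "has_third X"
  unfolding has_third_def
proof (intro allI)
  fix a b :: 'a
  have "card {a, b} \<le> 2" by (simp add: card_insert_if)
  then have "\<not> X \<subseteq> {a, b}"
    using assms card_mono[of "{a, b}" X] by auto
  then show "\<exists>d\<in>X. d \<noteq> a \<and> d \<noteq> b" by blast
qed

section \<open>Lines carrying three colors\<close>

text \<open>A line with three colors copies its coloring onto every parallel line that differs from
  it in both other coordinates. Such a line again has three colors, so two copying steps reach every
  parallel line.\<close>

lemma rainbow_line_imp_layers_monochromatic:
  assumes mf: "messy_free_along X Y Z f" and rl: "rainbow_line X Y Z f"
    and Y: "has_third Y" and Z: "has_third Z"
  shows "\<exists>g. \<forall>x\<in>X. \<forall>y\<in>Y. \<forall>z\<in>Z. f x y z = g x"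
proof -
  obtain a b d y z where pts: "a \<in> X" "b \<in> X" "d \<in> X" "y \<in> Y" "z \<in> Z"
    and ne: "f a y z \<noteq> f b y z" "f a y z \<noteq> f d y z" "f b y z \<noteq> f d y z"
    using rl unfolding rainbow_line_def by blast
  have off: "f e v' w' = f e v w"
    if "e \<in> X" "v \<in> Y" "w \<in> Z" "v' \<in> Y" "w' \<in> Z" "v' \<noteq> v" "w' \<noteq> w"
      and ne': "f a v w \<noteq> f b v w" "f a v w \<noteq> f d v w" "f b v w \<noteq> f d v w" for e v w v' w'
  proof -
    \<comment> \<open>Whatever the color of \<open>e\<close>, two of \<open>a\<close>,
      \<open>b\<close>, \<open>d\<close> have colors different from it and from each other. The two
      constraints they give share only the color of \<open>e\<close>.\<close>
    obtain p q where pq: "p \<in> X" "q \<in> X" "f p v w \<noteq> f e v w" "f q v w \<noteq> f e v w" "f p v w \<noteq> f q v w"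
      using ne' pts by metis
    have "f e v' w' \<in> {f p v w, f e v w}" "f e v' w' \<in> {f q v w, f e v w}"
      using mf pq that(1-7) unfolding messy_free_along_def by blast+
    then show ?thesis using pq(5) by auto
  qed
  have "f e v w = f e y z" if e: "e \<in> X" and v: "v \<in> Y" and w: "w \<in> Z" for e v w
  proof -
    \<comment> \<open>The intermediate line avoids both coordinates of the given line and of the
      target, so that \<open>off\<close> applies to each of the two steps.\<close>
    obtain y' z' where yz': "y' \<in> Y" "y' \<noteq> y" "y' \<noteq> v" "z' \<in> Z" "z' \<noteq> z" "z' \<noteq> w"
      using Y Z unfolding has_third_def by meson
    have *: "f x y' z' = f x y z" if "x \<in> X" for x
      using off[OF that pts(4,5) yz'(1,4,2,5) ne] .
    have "f e v w = f e y' z'"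
      by (rule off[OF e yz'(1,4) v w]) (use yz' ne * pts in auto)
    then show ?thesis using * e by simp
  qed
  then show ?thesis by (intro exI[of _ "\<lambda>e. f e y z"]) blast
qed

section \<open>Grids in which every line has at most two colors\<close>

definition two_colored_along ::
  "'x set \<Rightarrow> 'y set \<Rightarrow> 'z set \<Rightarrow> ('x \<Rightarrow> 'y \<Rightarrow> 'z \<Rightarrow> 'c) \<Rightarrow> bool" where
  "two_colored_along X Y Z f \<longleftrightarrow>
     (\<forall>a\<in>X. \<forall>b\<in>X. \<forall>y\<in>Y. \<forall>z\<in>Z. f a y z \<noteq> f b y z \<longrightarrow>
        (\<forall>x\<in>X. f x y z \<in> {f a y z, f b y z} \<and>
           (\<forall>y'\<in>Y. \<forall>z'\<in>Z. y' \<noteq> y \<longrightarrow> z' \<noteq> z \<longrightarrow> f x y' z' \<in> {f a y z, f b y z})))"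

lemma two_colored_alongD:
  assumes "two_colored_along X Y Z f" "f a y z \<noteq> f b y z" "a \<in> X" "b \<in> X" "y \<in> Y" "z \<in> Z" "x \<in> X"
  shows "f x y z \<in> {f a y z, f b y z}"
    and "y' \<in> Y \<Longrightarrow> z' \<in> Z \<Longrightarrow> y' \<noteq> y \<Longrightarrow> z' \<noteq> z \<Longrightarrow> f x y' z' \<in> {f a y z, f b y z}"
  using assms unfolding two_colored_along_def by simp_all

lemma two_colored_along_swap:
  "two_colored_along X Y Z f \<Longrightarrow> two_colored_along X Z Y (\<lambda>x z y. f x y z)"
  unfolding two_colored_along_def by simp

text \<open>Without a third color on the line, \<open>x\<close> has the color of \<open>a\<close> or
  of \<open>b\<close>. Pairing it with the one of the other color carries the constraint over to the
  layer of \<open>x\<close>.\<close>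

lemma two_colored_alongI:
  assumes "messy_free_along X Y Z f" "\<not> rainbow_line X Y Z f"
  shows "two_colored_along X Y Z f"
  unfolding two_colored_along_def
proof (intro ballI impI)
  fix a b y z x
  assume *: "a \<in> X" "b \<in> X" "y \<in> Y" "z \<in> Z" "f a y z \<noteq> f b y z" "x \<in> X"
  have line: "f x y z \<in> {f a y z, f b y z}"
    using assms(2) * unfolding rainbow_line_def by blast
  have "\<exists>p\<in>X. f p y z \<noteq> f x y z \<and> {f p y z, f x y z} = {f a y z, f b y z}"
  proof (cases "f x y z = f a y z")
    case True
    then show ?thesis using * by (intro bexI[of _ b]) auto
  next
    case False
    then show ?thesis using * line by (intro bexI[of _ a]) auto
  qed
  then obtain p where p: "p \<in> X" "f p y z \<noteq> f x y z" "{f p y z, f x y z} = {f a y z, f b y z}"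
    by blast
  have "f x y' z' \<in> {f p y z, f x y z}" if "y' \<in> Y" "z' \<in> Z" "y' \<noteq> y" "z' \<noteq> z" for y' z'
    using assms(1) p(1,2) * that unfolding messy_free_along_def by blast
  with line p(3) show "f x y z \<in> {f a y z, f b y z} \<and>
      (\<forall>y'\<in>Y. \<forall>z'\<in>Z. y' \<noteq> y \<longrightarrow> z' \<noteq> z \<longrightarrow> f x y' z' \<in> {f a y z, f b y z})"
    by auto
qed

text \<open>Bundling the three directions makes the hypothesis invariant under permuting
  coordinates, so that later arguments can treat a single direction.\<close>

definition two_colored ::
  "'x set \<Rightarrow> 'y set \<Rightarrow> 'z set \<Rightarrow> ('x \<Rightarrow> 'y \<Rightarrow> 'z \<Rightarrow> 'c) \<Rightarrow> bool" where
  "two_colored X Y Z f \<longleftrightarrow> has_third X \<and> has_third Y \<and> has_third Z \<and>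
     two_colored_along X Y Z f \<and> two_colored_along Y X Z (\<lambda>y x z. f x y z) \<and>
     two_colored_along Z X Y (\<lambda>z x y. f x y z)"

lemma two_colored_swap23: "two_colored X Y Z f \<Longrightarrow> two_colored X Z Y (\<lambda>x z y. f x y z)"
  unfolding two_colored_def by (simp add: two_colored_along_swap)

lemma two_colored_swap12: "two_colored X Y Z f \<Longrightarrow> two_colored Y X Z (\<lambda>y x z. f x y z)"
  unfolding two_colored_def
  by (simp add: two_colored_along_swap[of Z X Y "\<lambda>z x y. f x y z"])

text \<open>Two perpendicular lines through one point, showing three colors, force \<alpha> away
  from them and at the fourth vertex of their rectangle. Lines in the \<open>Y\<close> direction
  then force \<beta> and \<gamma> at two points outside the plane of the rectangle, and these
  contradict each other.\<close>

lemma two_colored_corner_absurd: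
  assumes tc: "two_colored X Y Z f"
    and a: "a \<in> X" and b: "b \<in> X" and y: "y \<in> Y" and z: "z \<in> Z" and z': "z' \<in> Z"
    and ab: "f a y z \<noteq> f b y z" and ac: "f a y z \<noteq> f a y z'" and bc: "f b y z \<noteq> f a y z'"
  shows False
proof -
  define \<alpha> \<beta> \<gamma> where "\<alpha> = f a y z" and "\<beta> = f b y z" and "\<gamma> = f a y z'"
  note greek = \<alpha>_def[symmetric] \<beta>_def[symmetric] \<gamma>_def[symmetric]
  have distinct: "\<alpha> \<noteq> \<beta>" "\<alpha> \<noteq> \<gamma>" "\<beta> \<noteq> \<gamma>" "a \<noteq> b" "z \<noteq> z'"
    using ab ac bc by (auto simp: \<alpha>_def \<beta>_def \<gamma>_def)
  have tcs: "two_colored_along X Y Z f" "two_colored_along Y X Z (\<lambda>y x z. f x y z)"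
      "two_colored_along Z X Y (\<lambda>z x y. f x y z)"
    using tc unfolding two_colored_def by auto
  have X: "f x v' w' \<in> {f p v w, f q v w}"
    if "f p v w \<noteq> f q v w" "p \<in> X" "q \<in> X" "v \<in> Y" "w \<in> Z" "x \<in> X" "v' \<in> Y" "w' \<in> Z"
      "v' \<noteq> v" "w' \<noteq> w" for p q v w x v' w'
    by (rule two_colored_alongD(2)[OF tcs(1)]) (use that in auto)
  have Y: "f u' v w' \<in> {f u p w, f u q w}"
    if "f u p w \<noteq> f u q w" "p \<in> Y" "q \<in> Y" "u \<in> X" "w \<in> Z" "v \<in> Y" "u' \<in> X" "w' \<in> Z"
      "u' \<noteq> u" "w' \<noteq> w" for p q u w v u' w'
    by (rule two_colored_alongD(2)[OF tcs(2)]) (use that in auto)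
  have Z: "f u' v' w \<in> {f u v p, f u v q}"
    if "f u v p \<noteq> f u v q" "p \<in> Z" "q \<in> Z" "u \<in> X" "v \<in> Y" "w \<in> Z" "u' \<in> X" "v' \<in> Y"
      "u' \<noteq> u" "v' \<noteq> v" for p q u v w u' v'
    by (rule two_colored_alongD(2)[OF tcs(3)]) (use that in auto)
  obtain x2 where x2: "x2 \<in> X" "x2 \<noteq> a" "x2 \<noteq> b"
    using tc unfolding two_colored_def has_third_def by meson
  obtain y1 where y1: "y1 \<in> Y" "y1 \<noteq> y"
    using tc unfolding two_colored_def has_third_def by meson
  obtain y2 where y2: "y2 \<in> Y" "y2 \<noteq> y" "y2 \<noteq> y1"
    using tc unfolding two_colored_def has_third_def by meson
  obtain z2 where z2: "z2 \<in> Z" "z2 \<noteq> z" "z2 \<noteq> z'"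
    using tc unfolding two_colored_def has_third_def by meson
  have 1: "f x v w \<in> {\<alpha>, \<beta>}" if "x \<in> X" "v \<in> Y" "w \<in> Z" "v \<noteq> y" "w \<noteq> z" for x v w
    using X[OF ab a b y z] that unfolding greek by blast
  have 2: "f x v w \<in> {\<alpha>, \<gamma>}" if "x \<in> X" "v \<in> Y" "w \<in> Z" "x \<noteq> a" "v \<noteq> y" for x v w
    using Z[OF ac z z' a y] that unfolding greek by blast
  \<comment> \<open>The \<open>X\<close>-line of the corner allows only \<alpha> and \<beta>, the
    \<open>Z\<close>-line only \<alpha> and \<gamma>.\<close>
  have 12: "f x v w = \<alpha>" if "x \<in> X" "v \<in> Y" "w \<in> Z" "x \<noteq> a" "v \<noteq> y" "w \<noteq> z" for x v w
    using 1[of x v w] 2[of x v w] that distinct by auto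
  \<comment> \<open>With \<gamma> at the fourth vertex, the \<open>Z\<close>-line through
    \<open>b\<close> would carry \<beta> and \<gamma> and exclude \<alpha> at a point where
    \<open>12\<close> forces it.\<close>
  have bz'_ne: "f b y z' \<noteq> \<gamma>"
  proof
    assume eq: "f b y z' = \<gamma>"
    then have "f x2 y1 z' \<in> {\<beta>, \<gamma>}"
      using Z[of b y z z' z' x2 y1] b y z z' x2 y1 distinct unfolding greek by auto
    moreover have "f x2 y1 z' = \<alpha>" using 12 x2 y1 z' distinct by auto
    ultimately show False using distinct by auto
  qed
  have 3: "f x v w \<in> {\<gamma>, f b y z'}" if "x \<in> X" "v \<in> Y" "w \<in> Z" "v \<noteq> y" "w \<noteq> z'" for x v w
    using X[of a y z' b x v w] a b y z' bz'_ne that unfolding greek by auto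
  \<comment> \<open>The point \<open>(b, y1, z2)\<close> has color \<alpha> by \<open>12\<close>, so
    \<alpha> must be the second color in \<open>3\<close>.\<close>
  have bz': "f b y z' = \<alpha>"
    using 3[of b y1 z2] 12[of b y1 z2] b y1 z2 distinct by auto
  have 4: "f x v w \<in> {\<alpha>, \<beta>}" if "x \<in> X" "v \<in> Y" "w \<in> Z" "x \<noteq> b" "v \<noteq> y" for x v w
    using Z[of b y z z' w x v] b y z z' bz' distinct that unfolding greek by auto
  \<comment> \<open>By \<open>4\<close> this color is not \<gamma>, so the \<open>Y\<close>-line at
    \<open>a\<close>, \<open>z'\<close> is not constant. Since it constrains
    \<open>(b, y, z)\<close>, of color \<beta>, its second color is \<beta>.\<close>
  have 5: "f a y1 z' = \<beta>"
  proof -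
    have "f a y1 z' \<in> {\<alpha>, \<beta>}" using 4 a y1 z' distinct by auto
    moreover from this have "f b y z \<in> {\<gamma>, f a y1 z'}"
      using Y[of a y z' y1 y b z] a b y y1 z z' distinct unfolding greek by auto
    ultimately show ?thesis using distinct unfolding greek by auto
  qed
  \<comment> \<open>The mirrored argument: the \<open>Y\<close>-line at \<open>b\<close>,
    \<open>z\<close> is not constant by \<open>2\<close> and constrains \<open>(a, y, z')\<close>,
    of color \<gamma>.\<close>
  have 6: "f b y2 z = \<gamma>"
  proof -
    have "f b y2 z \<in> {\<alpha>, \<gamma>}" using 2 b y2 z distinct by auto
    moreover from this have "f a y z' \<in> {\<beta>, f b y2 z}"
      using Y[of b y z y2 y a z'] a b y y2 z z' distinct unfolding greek by auto
    ultimately show ?thesis using distinct unfolding greek by auto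
  qed
  have 7: "f b y1 z' = \<alpha>" using 12 b y1 z' distinct by auto
  \<comment> \<open>The \<open>X\<close>-line at \<open>y1\<close>, \<open>z'\<close> carries
    \<beta> and \<alpha> by \<open>5\<close> and \<open>7\<close>. It constrains
    \<open>(b, y2, z)\<close> because \<open>y2\<close> was chosen different from
    \<open>y1\<close>.\<close>
  have "f b y2 z \<in> {\<beta>, \<alpha>}"
    using X[of a y1 z' b b y2 z] a b y1 y2 z z' distinct 5 7 by auto
  then show False using 6 distinct by auto
qed

text \<open>A third color at \<open>(x, y, z')\<close> would create a three-colored corner at
  \<open>(x, y, z)\<close>: the color there is that of \<open>a\<close> or \<open>b\<close>, and the
  point of the other color supplies the second leg.\<close>

lemma two_colored_line_plane:
  assumes tc: "two_colored X Y Z f"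
    and a: "a \<in> X" and b: "b \<in> X" and y: "y \<in> Y" and z: "z \<in> Z" and ab: "f a y z \<noteq> f b y z"
    and x: "x \<in> X" and z': "z' \<in> Z"
  shows "f x y z' \<in> {f a y z, f b y z}"
proof (rule ccontr)
  assume n: "f x y z' \<notin> {f a y z, f b y z}"
  have "f x y z \<in> {f a y z, f b y z}"
    using tc a b y z ab x two_colored_alongD(1)[of X Y Z f] unfolding two_colored_def by metis
  then show False
    using two_colored_corner_absurd[OF tc x b y z z'] two_colored_corner_absurd[OF tc x a y z z'] ab n
    by auto
qed

lemma two_colored_line:
  assumes tc: "two_colored X Y Z f"
    and ab: "a \<in> X" "b \<in> X" "y \<in> Y" "z \<in> Z" "f a y z \<noteq> f b y z"
    and p: "x \<in> X" "y' \<in> Y" "z' \<in> Z"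
  shows "f x y' z' \<in> {f a y z, f b y z}"
proof -
  consider "y' = y" | "z' = z" | "y' \<noteq> y" "z' \<noteq> z" by blast
  then show ?thesis
  proof cases
    case 1
    then show ?thesis using two_colored_line_plane[OF tc ab p(1,3)] by simp
  next
    case 2
    then show ?thesis
      using two_colored_line_plane[OF two_colored_swap23[OF tc] ab(1,2,4,3,5) p(1,2)] by simp
  next
    case 3
    then show ?thesis
      using tc ab p two_colored_alongD(2)[of X Y Z f a y z b x y' z'] unfolding two_colored_def by simp
  qed
qed

text \<open>A single non-constant line, in any direction, bounds the colors of the whole grid. If
  there is none, the coloring is constant.\<close>

lemma two_colored_at_most_two_colors:
  assumes tc: "two_colored X Y Z f"
  shows "\<exists>\<alpha> \<beta>. \<forall>x\<in>X. \<forall>y\<in>Y. \<forall>z\<in>Z. f x y z \<in> {\<alpha>, \<beta>}"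
proof (cases "\<exists>a\<in>X. \<exists>b\<in>X. \<exists>y\<in>Y. \<exists>z\<in>Z. f a y z \<noteq> f b y z")
  case True
  then show ?thesis using two_colored_line[OF tc] by meson
next
  case x: False
  show ?thesis
  proof (cases "\<exists>a\<in>Y. \<exists>b\<in>Y. \<exists>x\<in>X. \<exists>z\<in>Z. f x a z \<noteq> f x b z")
    case True
    then show ?thesis using two_colored_line[OF two_colored_swap12[OF tc]] by meson
  next
    case y: False
    show ?thesis
    proof (cases "\<exists>a\<in>Z. \<exists>b\<in>Z. \<exists>x\<in>X. \<exists>y\<in>Y. f x y a \<noteq> f x y b")
      case True
      then show ?thesis
        using two_colored_line[OF two_colored_swap12[OF two_colored_swap23[OF tc]]] by meson
    next
      case z: False
      obtain a b d where pts: "a \<in> X" "b \<in> Y" "d \<in> Z"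
        using tc unfolding two_colored_def has_third_def by meson
      have "f x y z = f a b d" if "x \<in> X" "y \<in> Y" "z \<in> Z" for x y z
        using x y z pts that by metis
      then show ?thesis by blast
    qed
  qed
qed

lemma messy_free_grid:
  assumes third: "has_third X" "has_third Y" "has_third Z"
    and mf: "messy_free_along X Y Z f" "messy_free_along Y X Z (\<lambda>y x z. f x y z)"
      "messy_free_along Z X Y (\<lambda>z x y. f x y z)"
    and three: "\<not> (\<exists>\<alpha> \<beta>. \<forall>x\<in>X. \<forall>y\<in>Y. \<forall>z\<in>Z. f x y z \<in> {\<alpha>, \<beta>})"
  shows "(\<exists>g. \<forall>x\<in>X. \<forall>y\<in>Y. \<forall>z\<in>Z. f x y z = g x) \<or> (\<exists>g. \<forall>x\<in>X. \<forall>y\<in>Y. \<forall>z\<in>Z. f x y z = g y) \<or>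
         (\<exists>g. \<forall>x\<in>X. \<forall>y\<in>Y. \<forall>z\<in>Z. f x y z = g z)"
proof -
  have "rainbow_line X Y Z f \<or> rainbow_line Y X Z (\<lambda>y x z. f x y z) \<or>
      rainbow_line Z X Y (\<lambda>z x y. f x y z)"
    using two_colored_at_most_two_colors[of X Y Z f] third mf three
    unfolding two_colored_def by (blast intro: two_colored_alongI)
  then show ?thesis
  proof (elim disjE)
    assume "rainbow_line X Y Z f"
    from rainbow_line_imp_layers_monochromatic[OF mf(1) this third(2,3)]
    show ?thesis by blast
  next
    assume "rainbow_line Y X Z (\<lambda>y x z. f x y z)"
    from rainbow_line_imp_layers_monochromatic[OF mf(2) this third(1,3)]
    show ?thesis by blast
  next
    assume "rainbow_line Z X Y (\<lambda>z x y. f x y z)"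
    from rainbow_line_imp_layers_monochromatic[OF mf(3) this third(1,2)]
    show ?thesis by blast
  qed
qed

section \<open>From the hypergraph to the grid and back\<close>

lemma contains_rainbow_messy_pathI:
  assumes dist: "distinct [v1, v2, v3, v4, v5, v6]"
    and E: "{v1, v2, v3} \<in> E" "{v2, v3, v4} \<in> E" "{v4, v5, v6} \<in> E"
    and c: "c {v1, v2, v3} \<noteq> c {v2, v3, v4}" "c {v1, v2, v3} \<noteq> c {v4, v5, v6}"
      "c {v2, v3, v4} \<noteq> c {v4, v5, v6}"
  shows "contains_rainbow_copy E c messy_path"
proof -
  \<comment> \<open>The vertices of the path are numbered from 1, list positions from 0.\<close>
  define \<phi> where "\<phi> = (\<lambda>i::nat. [v1, v2, v3, v4, v5, v6] ! (i - 1))"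
  have \<phi>: "\<phi> 1 = v1" "\<phi> (Suc 0) = v1" "\<phi> 2 = v2" "\<phi> 3 = v3" "\<phi> 4 = v4" "\<phi> 5 = v5" "\<phi> 6 = v6"
    by (simp_all add: \<phi>_def)
  have "inj_on \<phi> (\<Union>messy_path)"
    using dist by (auto simp: messy_path_def inj_on_def \<phi>)
  moreover have "{{v1, v2, v3}, {v2, v3, v4}, {v4, v5, v6}} = (\<lambda>e. \<phi> ` e) ` messy_path"
    by (simp add: messy_path_def \<phi>)
  ultimately have "is_copy messy_path {{v1, v2, v3}, {v2, v3, v4}, {v4, v5, v6}}"
    unfolding is_copy_def by blast
  moreover have "inj_on c {{v1, v2, v3}, {v2, v3, v4}, {v4, v5, v6}}"
    using c by (auto simp: inj_on_def)
  ultimately show ?thesis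
    unfolding contains_rainbow_copy_def using E by (metis empty_subsetI insert_subset)
qed

text \<open>The vertices \<open>a, y, z, b, y', z'\<close> in this order span a messy path: they are
  distinct because the sides are disjoint and differing colors force \<open>a\<close> and
  \<open>b\<close> apart. Keeping the sides arbitrary serves all three directions.\<close>

lemma messy_free_along_if_no_rainbow_copy:
  assumes nr: "\<not> contains_rainbow_copy E c messy_path"
    and E: "\<And>x y z. x \<in> X \<Longrightarrow> y \<in> Y \<Longrightarrow> z \<in> Z \<Longrightarrow> {x, y, z} \<in> E"
    and disj: "X \<inter> Y = {}" "X \<inter> Z = {}" "Y \<inter> Z = {}"
  shows "messy_free_along X Y Z (\<lambda>x y z. c {x, y, z})"
  unfolding messy_free_along_def
proof (intro ballI impI)
  fix a b y z y' z'
  assume *: "a \<in> X" "b \<in> X" "y \<in> Y" "z \<in> Z" "y' \<in> Y" "z' \<in> Z"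
    and ne: "c {a, y, z} \<noteq> c {b, y, z}" "y' \<noteq> y" "z' \<noteq> z"
  have perm: "{y, z, b} = {b, y, z}" by auto
  have "distinct [a, y, z, b, y', z']" using * ne disj by auto
  from contains_rainbow_messy_pathI[OF this, of E c, unfolded perm]
  have "c {a, y, z} = c {b, y', z'} \<or> c {b, y, z} = c {b, y', z'}"
    using nr ne(1) E[OF *(1,3,4)] E[OF *(2,3,4)] E[OF *(2,5,6)] by blast
  then show "c {b, y', z'} \<in> {c {a, y, z}, c {b, y, z}}" by auto
qed

text \<open>The parts are the color classes of \<open>g\<close> on \<open>W\<close>. They exhaust
  \<open>W\<close> because \<open>cover\<close> makes each \<open>g v\<close> a used color, and none
  is empty because an edge of each color has a vertex in \<open>W\<close> by
  \<open>meets\<close>.\<close>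

lemma partition_if_color_determined:
  assumes cover: "\<And>v. v \<in> W \<Longrightarrow> \<exists>e\<in>E. v \<in> e"
    and meets: "\<And>e. e \<in> E \<Longrightarrow> e \<inter> W \<noteq> {}"
    and det: "\<And>e v. e \<in> E \<Longrightarrow> v \<in> e \<Longrightarrow> v \<in> W \<Longrightarrow> c e = g v"
    and bij: "bij_betw color I (used_colors E c)"
  shows "\<exists>P. (\<Union>i\<in>I. P i) = W \<and> disjoint_family_on P I \<and> (\<forall>i\<in>I. P i \<noteq> {}) \<and>
             (\<forall>i\<in>I. \<forall>e\<in>E. e \<inter> P i \<noteq> {} \<longrightarrow> c e = color i)"
proof -
  have inj: "inj_on color I" and im: "color ` I = c ` E"
    using bij unfolding bij_betw_def used_colors_def by auto
  have g: "g v \<in> color ` I" if v: "v \<in> W" for v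
  proof -
    obtain e where "e \<in> E" "v \<in> e" using cover[OF v] by blast
    then show ?thesis using det[OF _ _ v] unfolding im by (metis imageI)
  qed
  let ?P = "\<lambda>i. {v \<in> W. g v = color i}"
  have "(\<Union>i\<in>I. ?P i) = W" using g by auto
  moreover have "disjoint_family_on ?P I"
    using inj unfolding disjoint_family_on_def inj_on_def by auto
  moreover have "?P i \<noteq> {}" if i: "i \<in> I" for i
  proof -
    obtain e where e: "e \<in> E" "c e = color i" using im i by (metis imageE imageI)
    then show ?thesis using meets[OF e(1)] det[OF e(1)] by fastforce
  qed
  moreover have "c e = color i" if "e \<in> E" "e \<inter> ?P i \<noteq> {}" for e i
    using det that by auto
  ultimately show ?thesis by (intro exI[of _ ?P]) blast
qed

theorem theorem1p14:
  fixes n k :: nat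
    and V :: "nat \<Rightarrow> 'a set"
    and c :: "'a set \<Rightarrow> 'c"
    and color :: "nat \<Rightarrow> 'c"
  assumes "n \<ge> 3"
    and "disjoint_family_on V {1, 2, 3}"
    and "\<And>j. j \<in> {1, 2, 3} \<Longrightarrow> finite (V j) \<and> card (V j) = n"
    and "\<not> contains_rainbow_copy (complete_tripartite3 V) c messy_path"
    and "k = card (used_colors (complete_tripartite3 V) c)"
    and "k \<ge> 3"
    and "bij_betw color {1..k} (used_colors (complete_tripartite3 V) c)"
  shows "\<exists>l \<in> {1, 2, 3}. \<exists>P :: nat \<Rightarrow> 'a set.
           (\<Union>i \<in> {1..k}. P i) = V l \<and>
           disjoint_family_on P {1..k} \<and>
           (\<forall>i \<in> {1..k}. P i \<noteq> {}) \<and>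
           (\<forall>i \<in> {1..k}. \<forall>e \<in> complete_tripartite3 V. e \<inter> P i \<noteq> {} \<longrightarrow> c e = color i)"
proof -
  let ?E = "complete_tripartite3 V" and ?f = "\<lambda>x y z. c {x, y, z}"
  have third: "has_third (V 1)" "has_third (V 2)" "has_third (V 3)"
    using assms(1,3) by (simp_all add: has_third_if_card_ge_3)
  have disj: "V 1 \<inter> V 2 = {}" "V 1 \<inter> V 3 = {}" "V 2 \<inter> V 3 = {}"
    using assms(2) unfolding disjoint_family_on_def by auto
  have disj': "V 2 \<inter> V 1 = {}" "V 3 \<inter> V 1 = {}" "V 3 \<inter> V 2 = {}"
    using disj by auto
  have E: "{x, y, z} \<in> ?E" if "x \<in> V 1" "y \<in> V 2" "z \<in> V 3" for x y z
    using that unfolding complete_tripartite3_def by blast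
  have E2: "{y, x, z} \<in> ?E" and E3: "{z, x, y} \<in> ?E"
    if "x \<in> V 1" "y \<in> V 2" "z \<in> V 3" for x y z
    using E[OF that] by (simp_all add: insert_commute)
  \<comment> \<open>Edges are unordered, so reading them from another side yields the same grid
    coloring.\<close>
  have perm: "(\<lambda>y x z. c {y, x, z}) = (\<lambda>y x z. ?f x y z)"
      "(\<lambda>z x y. c {z, x, y}) = (\<lambda>z x y. ?f x y z)"
    by (intro ext arg_cong[of _ _ c]; blast)+
  have mf: "messy_free_along (V 1) (V 2) (V 3) ?f"
    by (rule messy_free_along_if_no_rainbow_copy[OF assms(4) E disj])
  have "messy_free_along (V 2) (V 1) (V 3) (\<lambda>y x z. c {y, x, z})"
    by (rule messy_free_along_if_no_rainbow_copy[OF assms(4) E2 disj'(1) disj(3,2)])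
  then have mf2: "messy_free_along (V 2) (V 1) (V 3) (\<lambda>y x z. ?f x y z)"
    by (rule subst[OF perm(1), of "messy_free_along (V 2) (V 1) (V 3)"])
  have "messy_free_along (V 3) (V 1) (V 2) (\<lambda>z x y. c {z, x, y})"
    by (rule messy_free_along_if_no_rainbow_copy[OF assms(4) E3 disj'(2,3) disj(1)])
  then have mf3: "messy_free_along (V 3) (V 1) (V 2) (\<lambda>z x y. ?f x y z)"
    by (rule subst[OF perm(2), of "messy_free_along (V 3) (V 1) (V 2)"])
  have three: "\<not> (\<exists>\<alpha> \<beta>. \<forall>x\<in>V 1. \<forall>y\<in>V 2. \<forall>z\<in>V 3. ?f x y z \<in> {\<alpha>, \<beta>})"
  proof
    assume "\<exists>\<alpha> \<beta>. \<forall>x\<in>V 1. \<forall>y\<in>V 2. \<forall>z\<in>V 3. ?f x y z \<in> {\<alpha>, \<beta>}"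
    then obtain \<alpha> \<beta> where "used_colors ?E c \<subseteq> {\<alpha>, \<beta>}"
      unfolding used_colors_def complete_tripartite3_def by blast
    then have "k \<le> card {\<alpha>, \<beta>}" using assms(5) by (simp add: card_mono)
    also have "\<dots> \<le> 2" by (simp add: card_insert_if)
    finally show False using assms(6) by simp
  qed
  obtain p q r where pqr: "p \<in> V 1" "q \<in> V 2" "r \<in> V 3"
    using third unfolding has_third_def by meson
  have cover: "\<exists>e\<in>?E. v \<in> e" if vl: "v \<in> V l" "l \<in> {1, 2, 3}" for v l
  proof -
    consider "v \<in> V 1" | "v \<in> V 2" | "v \<in> V 3" using vl by blast
    then have "{v, q, r} \<in> ?E \<or> {p, v, r} \<in> ?E \<or> {p, q, v} \<in> ?E"
      using E pqr by cases auto
    then show ?thesis by (meson insertCI)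
  qed
  have meets: "e \<inter> V l \<noteq> {}" if "e \<in> ?E" "l \<in> {1, 2, 3}" for e l
    using that unfolding complete_tripartite3_def by auto
  \<comment> \<open>By disjointness an edge meets \<open>V l\<close> in one vertex only, so a
    coloring by layers is a function of that vertex.\<close>
  have "\<exists>l\<in>{1, 2, 3}. \<exists>g. \<forall>e\<in>?E. \<forall>v\<in>e. v \<in> V l \<longrightarrow> c e = g v"
    using messy_free_grid[OF third mf mf2 mf3 three]
  proof (elim disjE exE)
    fix g assume "\<forall>x\<in>V 1. \<forall>y\<in>V 2. \<forall>z\<in>V 3. ?f x y z = g x"
    then have "\<forall>e\<in>?E. \<forall>v\<in>e. v \<in> V 1 \<longrightarrow> c e = g v"
      using disj unfolding complete_tripartite3_def by auto
    then show ?thesis by blast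
  next
    fix g assume "\<forall>x\<in>V 1. \<forall>y\<in>V 2. \<forall>z\<in>V 3. ?f x y z = g y"
    then have "\<forall>e\<in>?E. \<forall>v\<in>e. v \<in> V 2 \<longrightarrow> c e = g v"
      using disj unfolding complete_tripartite3_def by auto
    then show ?thesis by blast
  next
    fix g assume "\<forall>x\<in>V 1. \<forall>y\<in>V 2. \<forall>z\<in>V 3. ?f x y z = g z"
    then have "\<forall>e\<in>?E. \<forall>v\<in>e. v \<in> V 3 \<longrightarrow> c e = g v"
      using disj unfolding complete_tripartite3_def by auto
    then show ?thesis by blast
  qed
  then obtain l g where l: "l \<in> {1, 2, 3}"
    and det: "\<And>e v. e \<in> ?E \<Longrightarrow> v \<in> e \<Longrightarrow> v \<in> V l \<Longrightarrow> c e = g v"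
    by blast
  show ?thesis
  proof (rule bexI[OF _ l], rule partition_if_color_determined[where g = g])
    show "\<exists>e\<in>?E. v \<in> e" if "v \<in> V l" for v
      using cover[OF that l] .
    show "e \<inter> V l \<noteq> {}" if "e \<in> ?E" for e
      using meets[OF that l] .
    show "c e = g v" if "e \<in> ?E" "v \<in> e" "v \<in> V l" for e v
      using det[OF that] .
    show "bij_betw color {1..k} (used_colors ?E c)"
      by (rule assms(7))
  qed
qed

end
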